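(* Let $\mathfrak{A}$ be a unital $C^*$-algebra and let $x\in\mathfrak{A}$. Then the following hold. (i) $\frac12\|x\| \le \frac12\sqrt{\big\|\,|x|^2+|x^*|^2\big\| + 2c(x^2)} \le v(x)$. (ii) $v(x)\le \frac12\sqrt{\big\|\,|x|^2+|x^*|^2\big\| + 2v(x^2)} \le \frac12\big(\|x\| + \|x^2\|^{1/2}\big)\le \|x\|$.
   Context: $\mathfrak{A}$ is a (nonzero, complex) $C^*$-algebra with unit $e$. For $x\in\mathfrak{A}$, $|x|^2=x^*x$ and $|x^*|^2=xx^*$. The set of normalized states is $\mathcal{S}(\mathfrak{A})=\{\varphi\in\mathfrak{A}':\varphi(e)=\|\varphi\|=1\}$, where $\mathfrak{A}'$ is the dual space of $\mathfrak{A}$. The numerical radius of $z\in\mathfrak{A}$ is $v(z)=\sup\{|\varphi(z)|:\varphi\in\mathcal{S}(\mathfrak{A})\}$, and the Crawford number of $z$ is $c(z)=\inf\{|\varphi(z)|:\varphi\in\mathcal{S}(\mathfrak{A})\}$. *)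

theory Defs
  imports "HOL-Analysis.Analysis"
begin

text \<open>Nonzero complex unital \<open>C\<^sup>*\<close>-algebras. The norm, completeness, submultiplicativity,
  \<open>0 \<noteq> 1\<close> and \<open>norm 1 = 1\<close> come from the superclasses; \<open>norm 1 = 1\<close> is no restriction, as it
  follows from the \<open>C\<^sup>*\<close>-identity and \<open>0 \<noteq> 1\<close>.\<close>

class unital_cstar_algebra = real_normed_algebra_1 + banach +
  fixes scaleC :: "complex \<Rightarrow> 'a \<Rightarrow> 'a"  (infixr "*\<^sub>C" 75)
    and star :: "'a \<Rightarrow> 'a"
  assumes scaleC_add_right: "a *\<^sub>C (x + y) = a *\<^sub>C x + a *\<^sub>C y"
    and scaleC_add_left: "(a + b) *\<^sub>C x = a *\<^sub>C x + b *\<^sub>C x"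
    and scaleC_scaleC: "a *\<^sub>C (b *\<^sub>C x) = (a * b) *\<^sub>C x"
    and scaleC_of_real: "complex_of_real r *\<^sub>C x = r *\<^sub>R x"
    and mult_scaleC_left: "(a *\<^sub>C x) * y = a *\<^sub>C (x * y)"
    and mult_scaleC_right: "x * (a *\<^sub>C y) = a *\<^sub>C (x * y)"
    and norm_scaleC: "norm (a *\<^sub>C x) = cmod a * norm x"
    and star_star: "star (star x) = x"
    and star_add: "star (x + y) = star x + star y"
    and star_scaleC: "star (a *\<^sub>C x) = cnj a *\<^sub>C star x"
    and star_mult: "star (x * y) = star y * star x"
    and norm_star_mult_self: "norm (star x * x) = (norm x)\<^sup>2"

definition dual_space :: "('a::unital_cstar_algebra \<Rightarrow> complex) set" where
  "dual_space = {\<phi>. bounded_linear \<phi> \<and> (\<forall>a x. \<phi> (a *\<^sub>C x) = a * \<phi> x)}"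

definition states :: "('a::unital_cstar_algebra \<Rightarrow> complex) set" where
  "states = {\<phi> \<in> dual_space. \<phi> 1 = 1 \<and> onorm \<phi> = 1}"

definition numerical_radius :: "'a::unital_cstar_algebra \<Rightarrow> real" where
  "numerical_radius z = (SUP \<phi>\<in>states. cmod (\<phi> z))"

definition crawford_number :: "'a::unital_cstar_algebra \<Rightarrow> real" where
  "crawford_number z = (INF \<phi>\<in>states. cmod (\<phi> z))"

end

theory Submission
  imports Defs
begin

text \<open>
  If \<open>h\<close> is the real part of \<open>u x\<close> with \<open>\<bar>u\<bar> = 1\<close>, then
  \<open>4 h\<^sup>2 = x\<^sup>* x + x x\<^sup>* + 2 Re (u\<^sup>2 x\<^sup>2)\<close>. Evaluating this at a state, with \<open>u\<close> chosen to
  rotate \<open>\<phi> x\<close> or \<open>\<phi> (x\<^sup>2)\<close> onto the positive axis, gives the two bounds that involve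
  \<open>v x\<close>. The first inequality is positivity of states on \<open>x x\<^sup>*\<close>.

  States attaining the norm of a self-adjoint element exist by Hahn--Banach, where the functional
  is a minimal sublinear functional below the norm. Spectral theory is avoided throughout: all that
  is needed of it follows from the square root of \<open>1 - a\<close> for self-adjoint \<open>a\<close> with
  \<open>norm a \<le> 1\<close>.
\<close>

section \<open>Hahn--Banach\<close>

definition sublinear :: "('a::real_vector \<Rightarrow> real) \<Rightarrow> bool" where
  "sublinear p \<longleftrightarrow> (\<forall>x y. p (x + y) \<le> p x + p y) \<and> (\<forall>t x. 0 \<le> t \<longrightarrow> p (t *\<^sub>R x) = t * p x)"

lemma sublinear_add: "sublinear p \<Longrightarrow> p (x + y) \<le> p x + p y"
  and sublinear_scaleR: "sublinear p \<Longrightarrow> 0 \<le> t \<Longrightarrow> p (t *\<^sub>R x) = t * p x"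
  by (auto simp: sublinear_def)

lemma sublinear_zero: "sublinear p \<Longrightarrow> p 0 = 0"
  using sublinear_scaleR[of p 0 0] by simp

lemma sublinear_minus_le: "sublinear p \<Longrightarrow> - p (- x) \<le> p x"
  using sublinear_add[of p x "- x"] sublinear_zero[of p] by simp

lemma sublinear_norm: "sublinear (norm :: 'a::real_normed_vector \<Rightarrow> real)"
  by (auto simp: sublinear_def norm_triangle_ineq)

text \<open>Any linear functional below \<open>tilt p y\<close> takes a value of at least
  \<open>p y\<close> at \<open>y\<close>, since the parameter \<open>t = 1\<close> gives
  \<open>tilt p y (- y) \<le> - p y\<close>; the parameter \<open>t = 0\<close> keeps the tilt below
  \<open>p\<close>.\<close>

definition tilt :: "('a::real_vector \<Rightarrow> real) \<Rightarrow> 'a \<Rightarrow> 'a \<Rightarrow> real" where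
  "tilt p y x = (INF t\<in>{0..}. p (x + t *\<^sub>R y) - t * p y)"

text \<open>The lower bound does not depend on \<open>t\<close>, so the infimum defining
  \<open>tilt\<close> is a genuine one.\<close>

lemma tilt_bound:
  assumes "sublinear p" "0 \<le> t"
  shows "- p (- x) \<le> p (x + t *\<^sub>R y) - t * p y"
  using sublinear_add[OF assms(1), of "x + t *\<^sub>R y" "- x"] sublinear_scaleR[OF assms, of y]
  by simp

lemma tilt_le:
  assumes "sublinear p" "0 \<le> t"
  shows "tilt p y x \<le> p (x + t *\<^sub>R y) - t * p y"
  unfolding tilt_def
  by (rule cINF_lower) (use assms tilt_bound[OF assms(1)] in \<open>auto intro!: bdd_belowI2[where m="- p (- x)"]\<close>)

lemma tilt_greatest:
  assumes "\<And>t. 0 \<le> t \<Longrightarrow> c \<le> p (x + t *\<^sub>R y) - t * p y"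
  shows "c \<le> tilt p y x"
  unfolding tilt_def by (rule cINF_greatest) (use assms in auto)

text \<open>Subadditivity: parameters \<open>s\<close> and \<open>t\<close> for the two summands
  combine to \<open>s + t\<close> for the sum. Homogeneity: scaling \<open>x\<close> by
  \<open>r\<close> scales the parameter by \<open>r\<close>.\<close>

lemma sublinear_tilt:
  assumes p: "sublinear p"
  shows "sublinear (tilt p y)"
  unfolding sublinear_def
proof (intro conjI allI impI)
  fix u v
  have *: "tilt p y (u + v) \<le> (p (u + s *\<^sub>R y) - s * p y) + (p (v + t *\<^sub>R y) - t * p y)"
    if "0 \<le> s" "0 \<le> t" for s t
    using tilt_le[OF p, of "s + t" y "u + v"] that
      sublinear_add[OF p, of "u + s *\<^sub>R y" "v + t *\<^sub>R y"]
    by (simp add: algebra_simps)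
  have "tilt p y (u + v) - (p (u + s *\<^sub>R y) - s * p y) \<le> tilt p y v" if "0 \<le> s" for s
    by (rule tilt_greatest) (use *[OF that] in \<open>auto simp: algebra_simps\<close>)
  then have "tilt p y (u + v) - tilt p y v \<le> tilt p y u"
    by (intro tilt_greatest) (auto simp: algebra_simps)
  then show "tilt p y (u + v) \<le> tilt p y u + tilt p y v" by simp
next
  fix r :: real and u assume r: "0 \<le> r"
  \<comment> \<open>One inequality for all positive factors suffices: the factor
    \<open>1 / r\<close>, applied to \<open>r *\<^sub>R u\<close>, gives its converse.\<close>
  have le: "tilt p y (r *\<^sub>R u) \<le> r * tilt p y u" if r: "0 < r" for r u
  proof -
    have "tilt p y (r *\<^sub>R u) / r \<le> tilt p y u"
    proof (rule tilt_greatest)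
      fix t :: real assume t: "0 \<le> t"
      have "tilt p y (r *\<^sub>R u) \<le> p (r *\<^sub>R (u + t *\<^sub>R y)) - (r * t) * p y"
        using tilt_le[OF p, of "r * t" y "r *\<^sub>R u"] r t by (simp add: scaleR_add_right)
      also have "\<dots> = r * (p (u + t *\<^sub>R y) - t * p y)"
        using r by (simp add: sublinear_scaleR[OF p] right_diff_distrib del: scaleR_add_right)
      finally show "tilt p y (r *\<^sub>R u) / r \<le> p (u + t *\<^sub>R y) - t * p y"
        using r by (simp add: field_simps)
    qed
    then show ?thesis using r by (simp add: field_simps)
  qed
  show "tilt p y (r *\<^sub>R u) = r * tilt p y u"
  proof (cases "r = 0")
    case True
    have "tilt p y 0 \<le> 0" using tilt_le[OF p, of 0 y 0] sublinear_zero[OF p] by simp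
    moreover have "0 \<le> tilt p y 0"
      by (rule tilt_greatest) (simp add: sublinear_scaleR[OF p])
    ultimately show ?thesis using True by simp
  next
    case False
    then have r: "0 < r" using r by simp
    have "tilt p y u \<le> (1 / r) * tilt p y (r *\<^sub>R u)"
      using le[of "1 / r" "r *\<^sub>R u"] r by simp
    then show ?thesis using le[OF r, of u] r by (simp add: field_simps)
  qed
qed

lemma tilt_le_self: "sublinear p \<Longrightarrow> tilt p y x \<le> p x"
  using tilt_le[of p 0 y x] by simp

text \<open>This supplies the bounds of chains for Zorn's lemma. The common majorant
  \<open>p\<close> keeps the infimum finite; comparability replaces two members of the chain by the
  smaller one, which yields subadditivity.\<close>

lemma sublinear_INF_chain:
  fixes C :: "('a::real_vector \<Rightarrow> real) set"
  assumes "C \<noteq> {}" and sub: "\<And>q. q \<in> C \<Longrightarrow> sublinear q" and le: "\<And>q. q \<in> C \<Longrightarrow> q \<le> p"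
    and chain: "\<And>q r. q \<in> C \<Longrightarrow> r \<in> C \<Longrightarrow> q \<le> r \<or> r \<le> q"
  defines "m \<equiv> \<lambda>x. INF q\<in>C. q x"
  shows "sublinear m" and "\<And>q. q \<in> C \<Longrightarrow> m \<le> q"
proof -
  have bdd: "bdd_below ((\<lambda>q. q x) ` C)" for x
  proof (rule bdd_belowI2[where m="- p (- x)"])
    fix q assume q: "q \<in> C"
    show "- p (- x) \<le> q x"
      using sublinear_minus_le[OF sub[OF q], of x] le_funD[OF le[OF q], of "- x"] by simp
  qed
  have lower: "m x \<le> q x" if "q \<in> C" for q x
    unfolding m_def by (rule cINF_lower[OF bdd that])
  then show "\<And>q. q \<in> C \<Longrightarrow> m \<le> q" by (simp add: le_fun_def)
  have greatest: "c \<le> m x" if "\<And>q. q \<in> C \<Longrightarrow> c \<le> q x" for c x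
    unfolding m_def by (rule cINF_greatest) (use assms that in auto)
  show "sublinear m"
    unfolding sublinear_def
  proof (intro conjI allI impI)
    fix u v
    have *: "m (u + v) \<le> q u + r v" if "q \<in> C" "r \<in> C" for q r
    proof -
      from chain[OF that] that obtain s where s: "s \<in> C" "s \<le> q" "s \<le> r"
        by (metis order_refl)
      have "m (u + v) \<le> s u + s v"
        using lower[OF s(1), of "u + v"] sublinear_add[OF sub[OF s(1)], of u v] by simp
      then show ?thesis using le_funD[OF s(2), of u] le_funD[OF s(3), of v] by simp
    qed
    have "m (u + v) - q u \<le> m v" if "q \<in> C" for q
      by (rule greatest) (use *[OF that] in \<open>auto simp: algebra_simps\<close>)
    then have "m (u + v) - m v \<le> m u"
      by (intro greatest) (auto simp: algebra_simps)
    then show "m (u + v) \<le> m u + m v" by simp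
  next
    fix r :: real and u assume r: "0 \<le> r"
    have le: "m (r *\<^sub>R u) \<le> r * m u" if r: "0 < r" for r u
    proof -
      have "m (r *\<^sub>R u) / r \<le> m u"
      proof (rule greatest)
        fix q assume q: "q \<in> C"
        show "m (r *\<^sub>R u) / r \<le> q u"
          using lower[OF q, of "r *\<^sub>R u"] sublinear_scaleR[OF sub[OF q], of r u] r
          by (simp add: field_simps)
      qed
      then show ?thesis using r by (simp add: field_simps)
    qed
    show "m (r *\<^sub>R u) = r * m u"
    proof (cases "r = 0")
      case True
      have "m 0 = (INF q\<in>C. (0::real))"
        unfolding m_def by (rule INF_cong) (auto simp: sublinear_zero sub)
      then show ?thesis using True assms(1) by simp
    next
      case False
      then have r: "0 < r" using r by simp
      have "m u \<le> (1 / r) * m (r *\<^sub>R u)"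
        using le[of "1 / r" "r *\<^sub>R u"] r by simp
      then show ?thesis using le[OF r, of u] r by (simp add: field_simps)
    qed
  qed
qed

text \<open>A minimal sublinear functional coincides with all its tilts, and the tilt bound at
  parameter 1 then reads as superadditivity.\<close>

lemma Hahn_Banach:
  fixes p :: "'a::real_vector \<Rightarrow> real"
  assumes p: "sublinear p"
  obtains f where "linear f" "\<And>x. f x \<le> p x"
proof -
  define A where "A = {q. sublinear q \<and> q \<le> p}"
  \<comment> \<open>The order is reversed so that the maximal element from Zorn's lemma is a minimal
    functional.\<close>
  define R where "R = (\<lambda>q r::'a \<Rightarrow> real. r \<le> q)"
  have po: "partial_order_on A (relation_of R A)"
    by (rule partial_order_on_relation_ofI) (auto simp: R_def)
  have "\<exists>q\<in>A. \<forall>r\<in>A. R q r \<longrightarrow> r = q"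
  proof (rule predicate_Zorn[OF po])
    fix C assume C: "C \<in> Chains (relation_of R A)"
    then have CA: "C \<subseteq> A" and ch: "\<And>q r. q \<in> C \<Longrightarrow> r \<in> C \<Longrightarrow> q \<le> r \<or> r \<le> q"
      by (auto simp: Chains_def relation_of_def R_def)
    show "\<exists>u\<in>A. \<forall>a\<in>C. R a u"
    proof (cases "C = {}")
      case True then show ?thesis using p by (auto simp: A_def)
    next
      case False
      then obtain q where q: "q \<in> C" by blast
      note inf = sublinear_INF_chain[OF False _ _ ch, of p]
      have "sublinear (\<lambda>x. INF q\<in>C. q x)" "\<And>q. q \<in> C \<Longrightarrow> (\<lambda>x. INF q\<in>C. q x) \<le> q"
        using inf CA by (auto simp: A_def)
      moreover from this(2)[OF q] have "(\<lambda>x. INF q\<in>C. q x) \<le> p"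
        using q CA by (auto simp: A_def intro: order_trans)
      ultimately show ?thesis by (intro bexI[of _ "\<lambda>x. INF q\<in>C. q x"]) (auto simp: A_def R_def)
    qed
  qed
  then obtain q where q: "sublinear q" "q \<le> p" and min: "\<And>r. sublinear r \<Longrightarrow> r \<le> q \<Longrightarrow> r = q"
    unfolding A_def R_def by (auto intro: order_trans)
  have tq: "tilt q y = q" for y
    by (rule min) (auto simp: sublinear_tilt q le_fun_def tilt_le_self)
  have add: "q (x + y) = q x + q y" for x y
    using tilt_le[OF q(1), of 1 y x] sublinear_add[OF q(1), of x y] by (simp add: tq)
  have neg: "q (- x) = - q x" for x
    using add[of x "- x"] sublinear_zero[OF q(1)] by simp
  have "q (r *\<^sub>R x) = r *\<^sub>R q x" for r x
  proof (cases "0 \<le> r")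
    case True then show ?thesis by (simp add: sublinear_scaleR[OF q(1)])
  next
    case False
    then show ?thesis using sublinear_scaleR[OF q(1), of "- r" x] neg[of "r *\<^sub>R x"] by simp
  qed
  with add have "linear q" by (auto intro: linearI)
  with q(2) show thesis by (auto simp: le_fun_def intro: that)
qed

text \<open>Hahn--Banach is applied below \<open>tilt norm y\<close> instead of \<open>norm\<close>,
  which forces the value at \<open>y\<close> up to \<open>norm y\<close>.\<close>

lemma norming_functional:
  fixes y :: "'a::real_normed_vector"
  obtains f where "linear f" "\<And>x. f x \<le> norm x" "f y = norm y"
proof -
  obtain f where f: "linear f" "\<And>x. f x \<le> tilt norm y x"
    using Hahn_Banach[OF sublinear_tilt[OF sublinear_norm]] by metis
  have "f x \<le> norm x" for x
    using f(2)[of x] tilt_le_self[OF sublinear_norm, of y x] by simp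
  moreover have "- f y \<le> - norm y"
    using f(2)[of "- y"] tilt_le[OF sublinear_norm, of 1 y "- y"] linear_neg[OF f(1), of y] by simp
  ultimately show thesis using f(1) by (intro that[of f]) (auto intro: antisym)
qed

section \<open>The involution and square roots\<close>

lemma scaleC_one [simp]: "1 *\<^sub>C x = (x::'a::unital_cstar_algebra)"
  using scaleC_of_real[of 1 x] by simp

lemma scaleC_zero_left [simp]: "0 *\<^sub>C x = (0::'a::unital_cstar_algebra)"
  using scaleC_of_real[of 0 x] by simp

lemma scaleC_zero_right [simp]: "a *\<^sub>C (0::'a::unital_cstar_algebra) = 0"
  using scaleC_add_right[of a 0 "0::'a"] by simp

lemma scaleC_minus_left: "(- a) *\<^sub>C x = - (a *\<^sub>C (x::'a::unital_cstar_algebra))"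
  by (rule minus_unique[symmetric]) (simp flip: scaleC_add_left)

lemma scaleC_minus_right: "a *\<^sub>C (- x) = - (a *\<^sub>C (x::'a::unital_cstar_algebra))"
  by (rule minus_unique[symmetric]) (simp flip: scaleC_add_right)

lemma scaleC_diff_right: "a *\<^sub>C (x - y) = a *\<^sub>C x - a *\<^sub>C (y::'a::unital_cstar_algebra)"
  using scaleC_add_right[of a x "- y"] by (simp add: scaleC_minus_right)

lemma star_scaleR: "star (r *\<^sub>R x) = r *\<^sub>R star (x::'a::unital_cstar_algebra)"
  using star_scaleC[of "complex_of_real r" x] by (simp add: scaleC_of_real)

lemma star_minus: "star (- x) = - star (x::'a::unital_cstar_algebra)"
  using star_scaleR[of "-1" x] by simp

lemma star_diff: "star (x - y) = star x - star (y::'a::unital_cstar_algebra)"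
  using star_add[of x "- y"] by (simp add: star_minus)

lemma star_zero [simp]: "star (0::'a::unital_cstar_algebra) = 0"
  using star_scaleR[of 0 0] by simp

lemma star_one [simp]: "star (1::'a::unital_cstar_algebra) = 1"
  using star_mult[of "1" "star (1::'a)"] by (simp add: star_star)

lemma norm_star [simp]: "norm (star x) = norm (x::'a::unital_cstar_algebra)"
proof -
  have le: "norm x \<le> norm (star x)" for x :: 'a
  proof (cases "x = 0")
    case False
    have "norm x * norm x \<le> norm (star x) * norm x"
      using norm_star_mult_self[of x] norm_mult_ineq[of "star x" x] by (simp add: power2_eq_square)
    with False show ?thesis by simp
  qed simp
  show ?thesis using le[of x] le[of "star x"] by (simp add: star_star)
qed

lemma norm_mult_star_self: "norm (x * star x) = (norm (x::'a::unital_cstar_algebra))\<^sup>2"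
  using norm_star_mult_self[of "star x"] by (simp add: star_star)

lemma bounded_linear_star: "bounded_linear (star :: 'a::unital_cstar_algebra \<Rightarrow> 'a)"
  by (rule bounded_linear_intro[where K=1]) (auto simp: star_add star_scaleR)

lemma norm_square_self_adjoint:
  "star h = h \<Longrightarrow> norm (h * h) = (norm (h::'a::unital_cstar_algebra))\<^sup>2"
  using norm_star_mult_self[of h] by simp

text \<open>The iteration converges to \<open>1 - sqrt (1 - a)\<close>; the iterates at the real number \<open>norm a\<close>
  majorize those at \<open>a\<close>, which gives convergence up to \<open>norm a = 1\<close>.\<close>

primrec sqrt_iter :: "'a::real_normed_algebra_1 \<Rightarrow> nat \<Rightarrow> 'a" where
  "sqrt_iter a 0 = 0"
| "sqrt_iter a (Suc n) = (1/2) *\<^sub>R (a + sqrt_iter a n * sqrt_iter a n)"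

text \<open>The iterates are polynomials in \<open>a\<close>. The property survives the limit, and
  the commutation it provides stands in for a functional calculus.\<close>

lemma sqrt_iter_commute:
  assumes "a * b = b * a"
  shows "sqrt_iter a n * b = b * sqrt_iter a n"
proof (induction n)
  case (Suc n)
  have "sqrt_iter a n * sqrt_iter a n * b = b * (sqrt_iter a n * sqrt_iter a n)"
    by (metis Suc.IH mult.assoc)
  then show ?case using assms by (simp add: distrib_left distrib_right)
qed simp

lemma norm_sqrt_iter_le: "norm (sqrt_iter a n) \<le> sqrt_iter (norm a) n"
proof (induction n)
  case (Suc n)
  have "norm (sqrt_iter a n * sqrt_iter a n) \<le> sqrt_iter (norm a) n * sqrt_iter (norm a) n"
    using norm_mult_ineq[of "sqrt_iter a n" "sqrt_iter a n"] mult_mono'[OF Suc Suc] by simp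
  then show ?case using norm_triangle_ineq[of a "sqrt_iter a n * sqrt_iter a n"] by simp
qed simp

text \<open>Consecutive iterates commute, so the difference of their squares factors; both factors
  are majorized by their real counterparts.\<close>

lemma norm_sqrt_iter_Suc_diff_le:
  "norm (sqrt_iter a (Suc n) - sqrt_iter a n) \<le> sqrt_iter (norm a) (Suc n) - sqrt_iter (norm a) n"
proof (induction n)
  case (Suc n)
  define y z q r where "y = sqrt_iter a n" and "z = sqrt_iter a (Suc n)"
    and "q = sqrt_iter (norm a) n" and "r = sqrt_iter (norm a) (Suc n)"
  have "a * y = y * a" unfolding y_def by (metis sqrt_iter_commute)
  then have comm: "z * y = y * z" unfolding y_def z_def by (metis sqrt_iter_commute)
  have "sqrt_iter a (Suc (Suc n)) - sqrt_iter a (Suc n) = (1/2) *\<^sub>R (z * z - y * y)"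
    by (simp add: y_def z_def algebra_simps)
  also have "z * z - y * y = (z - y) * (z + y)"
    using comm by (simp add: algebra_simps)
  finally have "norm (sqrt_iter a (Suc (Suc n)) - sqrt_iter a (Suc n))
      \<le> (1/2) * (norm (z - y) * norm (z + y))"
    using norm_mult_ineq[of "z - y" "z + y"] by simp
  also have "norm (z - y) * norm (z + y) \<le> (r - q) * (r + q)"
  proof (rule mult_mono)
    show "norm (z - y) \<le> r - q" using Suc by (simp add: y_def z_def q_def r_def)
    then show "0 \<le> r - q" using norm_ge_zero order_trans by blast
    show "norm (z + y) \<le> r + q"
      unfolding y_def z_def q_def r_def by (intro norm_triangle_mono norm_sqrt_iter_le)
  qed simp
  also have "(1/2) * ((r - q) * (r + q)) = sqrt_iter (norm a) (Suc (Suc n)) - sqrt_iter (norm a) (Suc n)"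
    by (simp add: q_def r_def algebra_simps)
  finally show ?case by simp
qed simp

lemma sqrt_iter_le_one:
  fixes a :: "'a::real_normed_algebra_1"
  shows "norm a \<le> 1 \<Longrightarrow> sqrt_iter (norm a) n \<le> 1"
proof (induction n)
  case (Suc n)
  have "0 \<le> sqrt_iter (norm a) n" using norm_sqrt_iter_le[of a n] norm_ge_zero order_trans by blast
  with Suc have "sqrt_iter (norm a) n * sqrt_iter (norm a) n \<le> 1" by (simp add: mult_le_one)
  with Suc show ?case by simp
qed simp

text \<open>The increments are dominated by those of a bounded increasing real sequence, whose
  series telescopes.\<close>

lemma convergent_sqrt_iter:
  fixes a :: "'a::{real_normed_algebra_1,banach}"
  assumes "norm a \<le> 1"
  shows "convergent (sqrt_iter a)"
proof -
  have inc: "incseq (sqrt_iter (norm a))"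
    by (rule incseq_SucI) (metis diff_ge_0_iff_ge norm_ge_zero norm_sqrt_iter_Suc_diff_le order_trans)
  have "convergent (sqrt_iter (norm a))"
    using incseq_convergent[OF inc, of 1] sqrt_iter_le_one[OF assms] unfolding convergent_def by metis
  then have "summable (\<lambda>n. sqrt_iter (norm a) (Suc n) - sqrt_iter (norm a) n)"
    by (metis convergent_LIMSEQ_iff telescope_summable)
  then have "summable (\<lambda>n. sqrt_iter a (Suc n) - sqrt_iter a n)"
    by (rule summable_comparison_test') (use norm_sqrt_iter_Suc_diff_le in auto)
  then have "convergent (\<lambda>n. \<Sum>i<n. sqrt_iter a (Suc i) - sqrt_iter a i)"
    by (simp add: summable_iff_convergent)
  then show ?thesis by (simp add: sum_lessThan_telescope del: sqrt_iter.simps(2))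
qed

text \<open>The root is \<open>1 - y\<close> with \<open>y\<close> the limit of the iteration: the
  fixed point equation \<open>2 y = a + y^2\<close> says \<open>(1 - y)^2 = 1 - a\<close>. The bound
  on \<open>norm (1 - m)\<close> allows a root of \<open>m\<close> itself to be taken later.\<close>

lemma self_adjoint_sqrt_one_minus:
  fixes a :: "'a::unital_cstar_algebra"
  assumes a: "star a = a" "norm a \<le> 1"
  obtains m where "star m = m" "m * m = 1 - a" "norm (1 - m) \<le> 1"
    "\<And>b. a * b = b * a \<Longrightarrow> m * b = b * m"
proof -
  obtain y where y: "sqrt_iter a \<longlonglongrightarrow> y"
    using convergent_sqrt_iter[OF a(2)] by (auto simp: convergent_def)
  have "star (sqrt_iter a n) = sqrt_iter a n" for n
    by (induction n) (auto simp: star_add star_scaleR star_mult a)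
  then have "(\<lambda>n. sqrt_iter a n) \<longlonglongrightarrow> star y"
    using bounded_linear.tendsto[OF bounded_linear_star y] by simp
  then have ys: "star y = y" using y LIMSEQ_unique by blast
  have "(\<lambda>n. sqrt_iter a (Suc n)) \<longlonglongrightarrow> (1/2) *\<^sub>R (a + y * y)"
    unfolding sqrt_iter.simps by (intro tendsto_intros y)
  then have yy: "y = (1/2) *\<^sub>R (a + y * y)"
    using LIMSEQ_Suc[OF y] LIMSEQ_unique by blast
  have y1: "norm y \<le> 1"
    by (rule LIMSEQ_le_const2[OF tendsto_norm[OF y]])
      (use norm_sqrt_iter_le[of a] sqrt_iter_le_one[OF a(2)] order_trans in blast)
  have yc: "y * b = b * y" if "a * b = b * a" for b
  proof (rule LIMSEQ_unique)
    show "(\<lambda>n. sqrt_iter a n * b) \<longlonglongrightarrow> y * b" by (intro tendsto_intros y)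
    show "(\<lambda>n. sqrt_iter a n * b) \<longlonglongrightarrow> b * y"
      unfolding sqrt_iter_commute[OF that] by (intro tendsto_intros y)
  qed
  have "y + y = a + y * y"
    using yy by (metis scaleR_2 scaleR_half_double scaleR_add_right)
  then have "(1 - y) * (1 - y) = 1 - a" by (simp add: algebra_simps)
  moreover have "(1 - y) * b = b * (1 - y)" if "a * b = b * a" for b
    using yc[OF that] by (simp add: left_diff_distrib right_diff_distrib)
  moreover have "star (1 - y) = 1 - y" "norm (1 - (1 - y)) \<le> 1"
    using ys y1 by (simp_all add: star_diff)
  ultimately show thesis using that by blast
qed

lemma self_adjoint_sqrt:
  fixes a :: "'a::unital_cstar_algebra"
  assumes a: "star a = a" "norm a \<le> s"
  obtains m where "star m = m" "m * m = of_real s - a" "\<And>b. a * b = b * a \<Longrightarrow> m * b = b * m"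
proof (cases "s = 0")
  case True
  then show thesis using a by (intro that[of 0]) auto
next
  case False
  then have s: "0 < s" using a(2) norm_ge_zero[of a] by linarith
  have "norm ((1 / s) *\<^sub>R a) \<le> 1" "star ((1 / s) *\<^sub>R a) = (1 / s) *\<^sub>R a"
    using s a by (auto simp: star_scaleR)
  then obtain m where m: "star m = m" "m * m = 1 - (1 / s) *\<^sub>R a"
    "\<And>b. ((1 / s) *\<^sub>R a) * b = b * ((1 / s) *\<^sub>R a) \<Longrightarrow> m * b = b * m"
    using self_adjoint_sqrt_one_minus by metis
  show thesis
  proof (rule that[of "sqrt s *\<^sub>R m"])
    show "star (sqrt s *\<^sub>R m) = sqrt s *\<^sub>R m" by (simp add: star_scaleR m)
    show "sqrt s *\<^sub>R m * sqrt s *\<^sub>R m = of_real s - a"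
      using s by (simp add: m scaleR_diff_right of_real_def)
    show "sqrt s *\<^sub>R m * b = b * sqrt s *\<^sub>R m" if "a * b = b * a" for b
      using m(3)[of b] that by simp
  qed
qed

section \<open>Norms of sums of squares of commuting self-adjoint elements\<close>

lemma norm_square_commuting:
  fixes h k :: "'a::unital_cstar_algebra"
  assumes "star h = h" "star k = k" "h * k = k * h"
  shows "(norm (h + \<i> *\<^sub>C k))\<^sup>2 = norm (h * h + k * k)"
proof -
  have "star (h + \<i> *\<^sub>C k) * (h + \<i> *\<^sub>C k) = h * h + k * k"
    by (simp add: star_add star_scaleC algebra_simps mult_scaleC_left mult_scaleC_right
        scaleC_scaleC assms scaleC_minus_left scaleC_add_right scaleC_diff_right)
  then show ?thesis using norm_star_mult_self by metis
qed

text \<open>\<open>h\<close> is the mean of \<open>h + \<i> *\<^sub>C k\<close> and its adjoint,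
  which have equal norm. This replaces monotonicity of the norm on positive elements.\<close>

lemma norm_real_part_le:
  fixes h k :: "'a::unital_cstar_algebra"
  assumes "star h = h" "star k = k" "h * k = k * h"
  shows "(norm h)\<^sup>2 \<le> norm (h * h + k * k)"
proof -
  define z where "z = h + \<i> *\<^sub>C k"
  have "2 *\<^sub>R h = z + star z"
    by (simp add: z_def star_add star_scaleC assms scaleC_minus_left scaleR_2)
  then have "2 * norm h \<le> norm z + norm (star z)"
    by (metis norm_scaleR norm_triangle_ineq abs_numeral)
  then have "(norm h)\<^sup>2 \<le> (norm z)\<^sup>2" by (simp add: power_mono)
  then show ?thesis by (simp add: z_def norm_square_commuting[OF assms])
qed

text \<open>With \<open>c\<close> a bound for both \<open>norm (1 + h)\<close> and \<open>norm (1 - h)\<close>, write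
  \<open>c - 1 - h = m\<^sup>2\<close> and \<open>c - 1 + h = n\<^sup>2\<close>; then \<open>h\<^sup>2 + (m n)\<^sup>2 = (c - 1)\<^sup>2\<close>.\<close>

lemma one_plus_norm_self_adjoint:
  fixes h :: "'a::unital_cstar_algebra"
  assumes h: "star h = h"
  shows "1 + norm h = norm (1 + h) \<or> 1 + norm h = norm (1 - h)"
proof -
  define c where "c = max (norm (1 + h)) (norm (1 - h))"
  have "star (1 + h) = 1 + h" "norm (1 + h) \<le> c" by (auto simp: star_add h c_def)
  then obtain m where m: "star m = m" "m * m = of_real c - (1 + h)"
    "\<And>b. (1 + h) * b = b * (1 + h) \<Longrightarrow> m * b = b * m"
    using self_adjoint_sqrt by metis
  have "star (1 - h) = 1 - h" "norm (1 - h) \<le> c" by (auto simp: star_diff h c_def)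
  then obtain n where n: "star n = n" "n * n = of_real c - (1 - h)"
    "\<And>b. (1 - h) * b = b * (1 - h) \<Longrightarrow> n * b = b * n"
    using self_adjoint_sqrt by metis
  have mh: "m * h = h * m" by (rule m(3)) (simp add: algebra_simps)
  have nh: "n * h = h * n" by (rule n(3)) (simp add: algebra_simps)
  \<comment> \<open>\<open>n\<close> commutes with \<open>h\<close>, hence with
    \<open>1 + h\<close>, and so with the root \<open>m\<close>.\<close>
  have mn: "m * n = n * m" by (rule m(3)) (simp add: algebra_simps nh)
  have c1: "1 \<le> c"
    using norm_triangle_ineq[of "1 + h" "1 - h"] unfolding c_def
    by (simp add: max_def)
  have "(m * n) * (m * n) = (m * m) * (n * n)" by (metis mn mult.assoc)
  also have "\<dots> = (of_real (c - 1) - h) * (of_real (c - 1) + h)"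
    unfolding m n by (simp add: algebra_simps)
  also have "\<dots> = of_real ((c - 1)\<^sup>2) - h * h"
    by (simp add: of_real_def power2_eq_square algebra_simps flip: scaleR_2)
  \<comment> \<open>Commuting makes \<open>m * n\<close> self-adjoint, so it can be the second
    summand in \<open>norm_real_part_le\<close>.\<close>
  finally have "(norm h)\<^sup>2 \<le> norm (of_real ((c - 1)\<^sup>2) :: 'a)"
    using norm_real_part_le[of h "m * n"] h m(1) n(1) mn mh nh
    by (metis (no_types, lifting) add.commute diff_add_cancel mult.assoc star_mult)
  then have "(norm h)\<^sup>2 \<le> (c - 1)\<^sup>2" by (simp only: norm_of_real) simp
  then have "norm h \<le> c - 1" using c1 by (simp add: power2_le_iff_abs_le)
  moreover have "c \<le> 1 + norm h"
    using norm_triangle_ineq[of 1 h] norm_triangle_ineq4[of 1 h] by (simp add: c_def)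
  ultimately have "c = 1 + norm h" by simp
  then show ?thesis unfolding c_def by (metis max_def)
qed

section \<open>States\<close>

text \<open>Since \<open>norm 1 = 1\<close>, the value 1 at the unit gives
  \<open>1 \<le> onorm \<phi>\<close>, so only contractivity remains to be required. Complex
  homogeneity contains the real one.\<close>

lemma states_iff:
  "\<phi> \<in> states \<longleftrightarrow>
    (\<forall>x y. \<phi> (x + y) = \<phi> x + \<phi> y) \<and> (\<forall>a x. \<phi> (a *\<^sub>C x) = a * \<phi> x) \<and>
    \<phi> 1 = 1 \<and> (\<forall>x. cmod (\<phi> x) \<le> norm (x::'a::unital_cstar_algebra))"
    (is "_ \<longleftrightarrow> ?R")
proof
  assume \<phi>: "\<phi> \<in> states"
  then have bl: "bounded_linear \<phi>" by (auto simp: states_def dual_space_def)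
  then interpret bounded_linear \<phi> .
  show ?R using \<phi> onorm[OF bl] add by (auto simp: states_def dual_space_def)
next
  assume R: ?R
  have "\<phi> (r *\<^sub>R x) = r *\<^sub>R \<phi> x" for r x
    using R scaleC_of_real[of r x] by (metis scaleR_conv_of_real)
  with R have bl: "bounded_linear \<phi>" by (intro bounded_linear_intro[where K=1]) auto
  have "onorm \<phi> \<le> 1" using R by (intro onorm_bound) auto
  moreover have "1 \<le> onorm \<phi>" using onorm[OF bl, of 1] R by simp
  ultimately show "\<phi> \<in> states" using R bl by (auto simp: states_def dual_space_def)
qed

lemma
  assumes "\<phi> \<in> states"
  shows state_add: "\<phi> (x + y) = \<phi> x + \<phi> y"
    and state_scaleC: "\<phi> (a *\<^sub>C x) = a * \<phi> x"
    and state_one: "\<phi> 1 = 1"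
    and state_norm_le: "cmod (\<phi> x) \<le> norm x"
  using assms by (auto simp: states_iff)

lemma state_scaleR: "\<phi> \<in> states \<Longrightarrow> \<phi> (r *\<^sub>R x) = of_real r * \<phi> x"
  using state_scaleC[of \<phi> "of_real r" x] by (simp add: scaleC_of_real)

lemma state_of_real: "\<phi> \<in> states \<Longrightarrow> \<phi> (of_real r) = of_real r"
  using state_scaleR[of \<phi> r 1] by (simp add: of_real_def state_one)

lemma state_minus: "\<phi> \<in> states \<Longrightarrow> \<phi> (- x) = - \<phi> x"
  using state_scaleR[of \<phi> "-1" x] by simp

lemma state_diff: "\<phi> \<in> states \<Longrightarrow> \<phi> (x - y) = \<phi> x - \<phi> y"
  using state_add[of \<phi> x "- y"] by (simp add: state_minus)

lemma unit_complex_rotating: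
  obtains u where "cmod u = 1" "u * z = of_real (cmod z)"
proof (cases "z = 0")
  case True then show thesis by (intro that[of 1]) auto
next
  case False
  show thesis
  proof (rule that[of "of_real (cmod z) / z"])
    show "cmod (of_real (cmod z) / z) = 1" using False by (simp add: norm_divide)
  qed (use False in simp)
qed

lemma Re_eq_bound_imp_eq:
  assumes "cmod z \<le> r" "Re z = r"
  shows "z = of_real r"
proof -
  have "(Re z)\<^sup>2 + (Im z)\<^sup>2 \<le> r\<^sup>2"
    using assms(1) by (metis cmod_power2 norm_ge_zero power_mono)
  then show ?thesis using assms(2) by (simp add: complex_eq_iff)
qed

text \<open>A real norming functional of \<open>1 + y\<close> is at most \<open>1\<close> at the
  unit and at most \<open>norm y\<close> at \<open>y\<close>; as the two values add up to
  \<open>1 + norm y\<close>, both bounds are attained.\<close>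

lemma state_attaining_norm:
  fixes y :: "'a::unital_cstar_algebra"
  assumes y: "norm (1 + y) = 1 + norm y"
  obtains \<phi> where "\<phi> \<in> states" "\<phi> y = of_real (norm y)"
proof -
  obtain f where f: "linear f" "\<And>x. f x \<le> norm x" "f (1 + y) = norm (1 + y)"
    using norming_functional[of "1 + y"] by metis
  interpret linear f by fact
  have f1: "f 1 = 1" and fy: "f y = norm y"
    using f(2)[of 1] f(2)[of y] f(3) y add[of 1 y] by auto
  \<comment> \<open>The complex-linear functional with real part \<open>f\<close>.\<close>
  define \<phi> where "\<phi> x = Complex (f x) (- f (\<i> *\<^sub>C x))" for x
  have scale: "f (a *\<^sub>C x) = Re a * f x + Im a * f (\<i> *\<^sub>C x)" for a x
  proof -
    have "a *\<^sub>C x = complex_of_real (Re a) *\<^sub>C x + complex_of_real (Im a) *\<^sub>C \<i> *\<^sub>C x"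
      by (metis complex_eq mult.commute scaleC_add_left scaleC_scaleC)
    then show ?thesis by (simp add: scaleC_of_real add scaleR)
  qed
  have \<phi>_add: "\<phi> (x + z) = \<phi> x + \<phi> z" for x z
    by (simp add: \<phi>_def scaleC_add_right add complex_eq_iff)
  have \<phi>_scale: "\<phi> (a *\<^sub>C x) = a * \<phi> x" for a x
    using scale[of a x] scale[of "\<i> * a" x]
    by (simp add: \<phi>_def complex_eq_iff scaleC_scaleC)
  have \<phi>_le: "cmod (\<phi> x) \<le> norm x" for x
  proof -
    \<comment> \<open>Rotating \<open>\<phi> x\<close> onto the positive axis turns its modulus into
      a value of \<open>f\<close>, where the real bound applies.\<close>
    obtain u where u: "cmod u = 1" "u * \<phi> x = of_real (cmod (\<phi> x))"
      using unit_complex_rotating by metis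
    have "cmod (\<phi> x) = Re (\<phi> (u *\<^sub>C x))" by (simp add: \<phi>_scale u(2))
    also have "\<dots> \<le> norm (u *\<^sub>C x)" using f(2) by (simp add: \<phi>_def)
    finally show ?thesis by (simp add: norm_scaleC u(1))
  qed
  \<comment> \<open>The real part already reaches the bound on the modulus, so the imaginary part
    vanishes.\<close>
  have "\<phi> 1 = of_real 1"
    by (rule Re_eq_bound_imp_eq) (use \<phi>_le[of 1] f1 in \<open>auto simp: \<phi>_def\<close>)
  then have "\<phi> \<in> states" using \<phi>_add \<phi>_scale \<phi>_le by (simp add: states_iff)
  moreover have "\<phi> y = of_real (norm y)"
    by (rule Re_eq_bound_imp_eq) (use \<phi>_le[of y] fy in \<open>auto simp: \<phi>_def\<close>)
  ultimately show thesis by (rule that)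
qed

text \<open>One of \<open>h\<close> and \<open>- h\<close> satisfies the norm equality with the
  unit; the sign disappears in the modulus.\<close>

lemma self_adjoint_state_attaining_norm:
  fixes h :: "'a::unital_cstar_algebra"
  assumes "star h = h"
  obtains \<phi> where "\<phi> \<in> states" "cmod (\<phi> h) = norm h"
  using one_plus_norm_self_adjoint[OF assms]
proof
  assume "1 + norm h = norm (1 + h)"
  then obtain \<phi> where "\<phi> \<in> states" "\<phi> h = of_real (norm h)"
    using state_attaining_norm[of h] by metis
  then show thesis by (intro that) auto
next
  assume "1 + norm h = norm (1 - h)"
  then obtain \<phi> where "\<phi> \<in> states" "\<phi> (- h) = of_real (norm (- h))"
    using state_attaining_norm[of "- h"] by auto
  then show thesis using that[of \<phi>] by (metis abs_norm_cancel norm_minus_cancel norm_of_real state_minus)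
qed

text \<open>This keeps the supremum and the infimum over states from ranging over the empty
  set.\<close>

lemma states_nonempty: "(states :: ('a::unital_cstar_algebra \<Rightarrow> complex) set) \<noteq> {}"
  using self_adjoint_state_attaining_norm[of "1::'a"] by auto

section \<open>Reality and positivity of states\<close>

lemma state_self_adjoint_real:
  assumes \<phi>: "\<phi> \<in> states" and h: "star h = h"
  shows "Im (\<phi> h) = 0"
proof (rule ccontr)
  assume b: "Im (\<phi> h) \<noteq> 0"
  \<comment> \<open>Adding \<open>\<i> t\<close> to \<open>h\<close> moves the imaginary part by
    \<open>t\<close>, whereas the squared norm grows by at most \<open>t^2\<close>.\<close>
  have key: "(Im (\<phi> h) + t)\<^sup>2 \<le> (norm h)\<^sup>2 + t\<^sup>2" for t
  proof -
    define z where "z = h + \<i> *\<^sub>C of_real t"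
    have "(norm z)\<^sup>2 = norm (h * h + of_real t * of_real t)"
      unfolding z_def
      by (rule norm_square_commuting) (simp_all add: h of_real_def star_scaleR)
    also have "\<dots> \<le> norm (h * h) + norm (of_real t * of_real t :: 'a)"
      by (rule norm_triangle_ineq)
    also have "\<dots> = (norm h)\<^sup>2 + t\<^sup>2"
      by (simp only: norm_square_self_adjoint[OF h] norm_of_real flip: of_real_mult)
        (simp add: power2_eq_square)
    finally have *: "(norm z)\<^sup>2 \<le> (norm h)\<^sup>2 + t\<^sup>2" .
    have "\<phi> z = \<phi> h + \<i> * of_real t"
      by (simp add: z_def state_add[OF \<phi>] state_scaleC[OF \<phi>] state_of_real[OF \<phi>])
    then have "\<bar>Im (\<phi> h) + t\<bar> \<le> \<bar>norm z\<bar>"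
      using abs_Im_le_cmod[of "\<phi> z"] state_norm_le[OF \<phi>, of z] by simp
    then have "(Im (\<phi> h) + t)\<^sup>2 \<le> (norm z)\<^sup>2" by (simp only: abs_le_square_iff)
    with * show ?thesis by simp
  qed
  \<comment> \<open>This \<open>t\<close> makes the cross term \<open>2 * Im (\<phi> h) * t\<close>
    exceed \<open>(norm h)^2\<close> by one, whatever the sign of
    \<open>Im (\<phi> h)\<close>.\<close>
  define t where "t = ((norm h)\<^sup>2 + 1) / (2 * Im (\<phi> h))"
  have "2 * Im (\<phi> h) * t = (norm h)\<^sup>2 + 1" using b by (simp add: t_def)
  moreover have "(Im (\<phi> h))\<^sup>2 + 2 * Im (\<phi> h) * t \<le> (norm h)\<^sup>2"
    using key[of t] by (simp add: power2_sum)
  moreover have "0 \<le> (Im (\<phi> h))\<^sup>2" by simp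
  ultimately show False by linarith
qed

text \<open>With \<open>t = (norm k)^2\<close> and \<open>n\<close> a root of \<open>t - k^2\<close>
  commuting with \<open>k\<close>, the sum \<open>n^2 + k^2 = t\<close> bounds
  \<open>norm (t - k^2)\<close> by \<open>t\<close>. Hence \<open>\<phi> (k * k)\<close> lies in the
  disc of radius \<open>t\<close> around \<open>t\<close>.\<close>

lemma state_square_nonneg:
  assumes \<phi>: "\<phi> \<in> states" and k: "star k = k"
  shows "0 \<le> Re (\<phi> (k * k))"
proof -
  define t where "t = (norm k)\<^sup>2"
  have "star (k * k) = k * k" "norm (k * k) \<le> t"
    by (auto simp: star_mult k t_def norm_square_self_adjoint)
  then obtain n where n: "star n = n" "n * n = of_real t - k * k"
    "\<And>b. (k * k) * b = b * (k * k) \<Longrightarrow> n * b = b * n"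
    using self_adjoint_sqrt by metis
  have "n * k = k * n" by (rule n(3)) (simp add: mult.assoc)
  from norm_real_part_le[OF n(1) k this] have "(norm n)\<^sup>2 \<le> norm (of_real t :: 'a)"
    by (simp add: n(2))
  then have "norm (of_real t - k * k) \<le> \<bar>t\<bar>"
    by (simp only: norm_of_real norm_square_self_adjoint[OF n(1)] flip: n(2))
  then have "norm (of_real t - k * k) \<le> t" by (simp add: t_def)
  with state_norm_le[OF \<phi>, of "of_real t - k * k"]
  have "cmod (of_real t - \<phi> (k * k)) \<le> t"
    by (simp add: state_diff[OF \<phi>] state_of_real[OF \<phi>])
  then show ?thesis
    using abs_Re_le_cmod[of "of_real t - \<phi> (k * k)"] by simp
qed

text \<open>The variance of \<open>h\<close> in the state \<open>\<phi>\<close> is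
  nonnegative.\<close>

lemma state_square_ge:
  assumes \<phi>: "\<phi> \<in> states" and h: "star h = h"
  shows "(Re (\<phi> h))\<^sup>2 \<le> Re (\<phi> (h * h))"
proof -
  define r where "r = Re (\<phi> h)"
  have "(h - of_real r) * (h - of_real r) = h * h - (r *\<^sub>R h + r *\<^sub>R h) + of_real (r\<^sup>2)"
    by (simp add: of_real_def algebra_simps power2_eq_square)
  moreover have "star (h - of_real r) = h - of_real r"
    by (simp add: star_diff h of_real_def star_scaleR)
  ultimately have "0 \<le> Re (\<phi> (h * h - (r *\<^sub>R h + r *\<^sub>R h) + of_real (r\<^sup>2)))"
    using state_square_nonneg[OF \<phi>] by metis
  also have "\<dots> = Re (\<phi> (h * h)) - r\<^sup>2"
    by (simp add: state_add[OF \<phi>] state_diff[OF \<phi>] state_scaleR[OF \<phi>] state_of_real[OF \<phi>] del: of_real_power)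
      (simp add: r_def power2_eq_square)
  finally show ?thesis by (simp add: r_def)
qed

text \<open>A state is real on the self-adjoint elements \<open>x + star x\<close> and
  \<open>\<i> *\<^sub>C (x - star x)\<close>, which fixes the imaginary and the real part.\<close>

lemma state_star:
  assumes \<phi>: "\<phi> \<in> states"
  shows "\<phi> (star x) = cnj (\<phi> x)"
proof -
  have "star (x + star x) = x + star x" by (simp add: star_add star_star add.commute)
  from state_self_adjoint_real[OF \<phi> this] have 1: "Im (\<phi> (star x)) = - Im (\<phi> x)"
    by (simp add: state_add[OF \<phi>])
  have "star (\<i> *\<^sub>C (x - star x)) = \<i> *\<^sub>C (x - star x)"
    by (simp add: star_scaleC star_diff star_star scaleC_minus_left scaleC_diff_right)
  from state_self_adjoint_real[OF \<phi> this] have "Re (\<phi> (star x)) = Re (\<phi> x)"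
    by (simp add: state_scaleC[OF \<phi>] state_diff[OF \<phi>])
  with 1 show ?thesis by (simp add: complex_eq_iff)
qed

section \<open>Positivity of \<open>star x * x\<close>\<close>

lemma star_mult_add_mult_star_eq:
  fixes x :: "'a::unital_cstar_algebra"
  obtains h k where "star h = h" "star k = k" "star x * x + x * star x = h * h + k * k"
proof
  \<comment> \<open>The squares of \<open>x + star x\<close> and
    \<open>\<i> *\<^sub>C (x - star x)\<close> add up to twice the desired element; \<open>r\<close>
    removes the factor 2.\<close>
  define r where "r = sqrt (1/2)"
  let ?h = "r *\<^sub>R (x + star x)" and ?k = "r *\<^sub>R (\<i> *\<^sub>C (x - star x))"
  show "star ?h = ?h" by (simp add: star_scaleR star_add star_star add.commute)
  show "star ?k = ?k"
    by (simp add: star_scaleR star_scaleC star_diff star_star scaleC_minus_left scaleC_diff_right)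
  have r: "r * r = 1/2" by (simp add: r_def)
  have "?h * ?h + ?k * ?k = (r * r) *\<^sub>R
      ((x + star x) * (x + star x) + (\<i> *\<^sub>C (x - star x)) * (\<i> *\<^sub>C (x - star x)))"
    by (subst scaleR_add_right[of "r * r"]) (simp only: mult_scaleR_left mult_scaleR_right scaleR_scaleR)
  also have "(\<i> *\<^sub>C (x - star x)) * (\<i> *\<^sub>C (x - star x)) = - ((x - star x) * (x - star x))"
    by (simp add: mult_scaleC_left mult_scaleC_right scaleC_scaleC scaleC_minus_left)
  also have "(x + star x) * (x + star x) + - ((x - star x) * (x - star x)) =
      2 *\<^sub>R (star x * x + x * star x)"
    by (simp add: algebra_simps scaleR_2)
  finally show "star x * x + x * star x = ?h * ?h + ?k * ?k" by (simp add: r)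
qed

text \<open>Positivity of the sum comes before that of its summands, and the proof of the latter
  rests on it.\<close>

lemma state_star_mult_add_mult_star_nonneg:
  "\<phi> \<in> states \<Longrightarrow> 0 \<le> Re (\<phi> (star x * x + x * star x))"
  by (rule star_mult_add_mult_star_eq[of x]) (simp add: state_add state_square_nonneg)

text \<open>If \<open>y\<^sup>* y = - q\<^sup>2\<close> with \<open>t = (norm y)\<^sup>2\<close>, then \<open>y y\<^sup>*\<close> is positive, so
  \<open>norm (t - y y\<^sup>*) \<le> t\<close>, while \<open>y\<^sup>* (t - y y\<^sup>*) y = - (t q\<^sup>2 + q\<^sup>4)\<close> has norm at least \<open>2 t\<^sup>2\<close>.\<close>

lemma star_mult_self_eq_minus_square_imp_zero:
  fixes y :: "'a::unital_cstar_algebra"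
  assumes q: "star q = q" and y: "star y * y = - (q * q)"
  shows "y = 0"
proof -
  define t where "t = (norm y)\<^sup>2"
  define d where "d = of_real t - y * star y"
  have t0: "0 \<le> t" by (simp add: t_def)
  have ds: "star d = d"
    by (simp add: d_def star_diff star_mult star_star of_real_def star_scaleR)
  have "norm d \<le> t"
  proof -
    obtain \<phi> where \<phi>: "\<phi> \<in> states" "cmod (\<phi> d) = norm d"
      using self_adjoint_state_attaining_norm[OF ds] by metis
    \<comment> \<open>By the hypothesis on \<open>star y * y\<close>, adding \<open>q * q\<close> to
      the symmetric sum leaves \<open>y * star y\<close>, and both terms are nonnegative in a
      state.\<close>
    have yy: "\<phi> (y * star y) = \<phi> (star y * y + y * star y) + \<phi> (q * q)"
      by (simp add: state_add[OF \<phi>(1), symmetric] y)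
    have "0 \<le> Re (\<phi> (y * star y))"
      unfolding yy using state_star_mult_add_mult_star_nonneg[OF \<phi>(1), of y]
        state_square_nonneg[OF \<phi>(1) q] by simp
    moreover have "Re (\<phi> (y * star y)) \<le> t"
      using complex_Re_le_cmod[of "\<phi> (y * star y)"] state_norm_le[OF \<phi>(1), of "y * star y"]
      by (simp add: norm_mult_star_self t_def)
    moreover have "Re (\<phi> d) = t - Re (\<phi> (y * star y))"
      by (simp add: d_def state_diff[OF \<phi>(1)] state_of_real[OF \<phi>(1)])
    moreover have "cmod (\<phi> d) = \<bar>Re (\<phi> d)\<bar>"
      using state_self_adjoint_real[OF \<phi>(1) ds] by (simp add: cmod_eq_Re)
    ultimately show ?thesis using \<phi>(2) by simp
  qed
  have "star y * d * y = t *\<^sub>R (star y * y) - (star y * y) * (star y * y)"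
    by (simp add: d_def algebra_simps of_real_def mult.assoc)
  also have "\<dots> = - (t *\<^sub>R (q * q) + (q * q) * (q * q))" by (simp add: y)
  finally have eq: "star y * d * y = - (t *\<^sub>R (q * q) + (q * q) * (q * q))" .
  have "norm (star y * d * y) \<le> norm (star y) * norm d * norm y"
    by (meson norm_mult_ineq mult_right_mono norm_ge_zero order_trans)
  also have "\<dots> \<le> norm y * t * norm y" using \<open>norm d \<le> t\<close>
    by (intro mult_right_mono) (auto intro: mult_left_mono)
  also have "\<dots> = t\<^sup>2" by (simp add: t_def power2_eq_square)
  finally have ub: "norm (t *\<^sub>R (q * q) + (q * q) * (q * q)) \<le> t\<^sup>2"
    unfolding eq by (simp only: norm_minus_cancel)
  have qqs: "star (q * q) = q * q" by (simp add: star_mult q)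
  \<comment> \<open>In this state \<open>q^2\<close> has the value \<open>t\<close>, so
    \<open>q^4\<close> has a value of at least \<open>t^2\<close> by nonnegative variance.\<close>
  obtain \<phi> where \<phi>: "\<phi> \<in> states" "cmod (\<phi> (q * q)) = norm (q * q)"
    using self_adjoint_state_attaining_norm[OF qqs] by metis
  have "norm (q * q) = t" using y norm_star_mult_self[of y] by (simp add: t_def)
  moreover have "cmod (\<phi> (q * q)) = Re (\<phi> (q * q))"
    using state_self_adjoint_real[OF \<phi>(1) qqs] state_square_nonneg[OF \<phi>(1) q]
    by (simp add: cmod_eq_Re)
  ultimately have "Re (\<phi> (q * q)) = t" using \<phi>(2) by simp
  then have "2 * t\<^sup>2 \<le> Re (\<phi> (t *\<^sub>R (q * q) + (q * q) * (q * q)))"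
    using state_square_ge[OF \<phi>(1) qqs]
    by (simp add: state_add[OF \<phi>(1)] state_scaleR[OF \<phi>(1)] power2_eq_square)
  also have "\<dots> \<le> t\<^sup>2"
    by (rule order_trans[OF complex_Re_le_cmod order_trans[OF state_norm_le[OF \<phi>(1)] ub]])
  finally have "t = 0" by simp
  then show ?thesis by (simp add: t_def)
qed

text \<open>Let \<open>a = x\<^sup>* x\<close>, \<open>m = |a| = r\<^sup>2\<close> and \<open>c\<close> the negative part of \<open>2 a\<close>.
  Then \<open>y = x c\<close> satisfies \<open>y\<^sup>* y = - (r c)\<^sup>2\<close>, whence \<open>c = 0\<close> and \<open>a = m = r\<^sup>2\<close>.\<close>

lemma star_mult_self_eq_square:
  fixes x :: "'a::unital_cstar_algebra"
  assumes "norm x \<le> 1"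
  obtains r where "star r = r" "star x * x = r * r"
proof -
  define a where "a = star x * x"
  have as: "star a = a" by (simp add: a_def star_mult star_star)
  have "norm a \<le> 1" using assms by (simp add: a_def norm_star_mult_self power_le_one)
  then have "norm (a * a) \<le> 1" by (simp add: norm_square_self_adjoint[OF as] power_le_one)
  have ss: "star (1 - a * a) = 1 - a * a" by (simp add: star_diff star_mult as)
  \<comment> \<open>Every state takes a value between 0 and 1 at \<open>a * a\<close>, and one state
    attains the norm of \<open>1 - a * a\<close>.\<close>
  have "norm (1 - a * a) \<le> 1"
  proof -
    obtain \<phi> where \<phi>: "\<phi> \<in> states" "cmod (\<phi> (1 - a * a)) = norm (1 - a * a)"
      using self_adjoint_state_attaining_norm[OF ss] by metis
    have "cmod (\<phi> (1 - a * a)) = \<bar>Re (\<phi> (1 - a * a))\<bar>"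
      using state_self_adjoint_real[OF \<phi>(1) ss] by (simp add: cmod_eq_Re)
    also have "\<dots> = \<bar>1 - Re (\<phi> (a * a))\<bar>"
      by (simp add: state_diff[OF \<phi>(1)] state_one[OF \<phi>(1)])
    also have "\<dots> \<le> 1"
      using state_square_nonneg[OF \<phi>(1) as] complex_Re_le_cmod[of "\<phi> (a * a)"]
        state_norm_le[OF \<phi>(1), of "a * a"] \<open>norm (a * a) \<le> 1\<close> by linarith
    finally show ?thesis using \<phi>(2) by simp
  qed
  from self_adjoint_sqrt_one_minus[OF ss this]
  obtain m where m: "star m = m" "m * m = 1 - (1 - a * a)" "norm (1 - m) \<le> 1"
    "\<And>b. (1 - a * a) * b = b * (1 - a * a) \<Longrightarrow> m * b = b * m"
    by metis
  have mm: "m * m = a * a" by (simp add: m(2))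
  have ma: "m * a = a * m" by (rule m(4)) (simp add: algebra_simps)
  \<comment> \<open>The bound on \<open>norm (1 - m)\<close> admits a second root extraction, giving
    a root of \<open>m\<close>.\<close>
  have "star (1 - m) = 1 - m" by (simp add: star_diff m(1))
  from self_adjoint_sqrt_one_minus[OF this m(3)]
  obtain r where r: "star r = r" "r * r = 1 - (1 - m)"
    "\<And>b. (1 - m) * b = b * (1 - m) \<Longrightarrow> r * b = b * r"
    by metis
  have rr: "r * r = m" by (simp add: r(2))
  have ra: "r * a = a * r" by (rule r(3)) (simp add: algebra_simps ma)
  have rm: "r * m = m * r" by (rule r(3)) (simp add: algebra_simps)
  define c where "c = m - a"
  have cs: "star c = c" by (simp add: c_def star_diff m(1) as)
  have rc: "r * c = c * r" by (simp add: c_def algebra_simps ra rm)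
  \<comment> \<open>Equivalent to \<open>(m + a) * (m - a) = 0\<close>, which holds because
    \<open>m\<close> and \<open>a\<close> commute and have equal squares.\<close>
  have ac: "a * c = - (m * c)" and ca: "c * a = a * c"
    by (auto simp: c_def algebra_simps mm ma)
  have rcrc: "(r * c) * (r * c) = m * c * c" by (metis rc rr mult.assoc)
  have "star (x * c) * (x * c) = c * a * c"
    by (simp add: star_mult cs a_def mult.assoc)
  also have "\<dots> = - ((r * c) * (r * c))"
    by (simp add: ca ac rcrc)
  finally have "x * c = 0"
    using star_mult_self_eq_minus_square_imp_zero[of "r * c" "x * c"]
    by (simp add: star_mult r(1) cs rc)
  then have "a * c = 0" by (simp add: a_def mult.assoc)
  then have "c * c = 0" using ac by (simp add: c_def algebra_simps)
  then have "c = 0" using norm_square_self_adjoint[OF cs] by simp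
  then show thesis using r(1) rr that[of r] by (simp add: c_def a_def)
qed

text \<open>After scaling \<open>x\<close> to norm one, \<open>star x * x\<close> is the square of a
  self-adjoint element.\<close>

lemma state_star_mult_self_nonneg:
  assumes \<phi>: "\<phi> \<in> states"
  shows "0 \<le> Re (\<phi> (star x * x))"
proof (cases "x = 0")
  case True
  then show ?thesis using state_of_real[OF \<phi>, of 0] by simp
next
  case False
  obtain r where r: "star r = r" "star ((1 / norm x) *\<^sub>R x) * ((1 / norm x) *\<^sub>R x) = r * r"
    using star_mult_self_eq_square[of "(1 / norm x) *\<^sub>R x"] False by auto
  have "Re (\<phi> (star ((1 / norm x) *\<^sub>R x) * ((1 / norm x) *\<^sub>R x)))
      = (1 / norm x * (1 / norm x)) * Re (\<phi> (star x * x))"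
    by (simp add: star_scaleR state_scaleR[OF \<phi>])
  then have "0 \<le> (1 / norm x * (1 / norm x)) * Re (\<phi> (star x * x))"
    using state_square_nonneg[OF \<phi> r(1)] r(2) by simp
  then show ?thesis using False by (simp add: zero_le_divide_iff mult_le_0_iff)
qed

lemma state_attaining_norm_nonneg:
  fixes h :: "'a::unital_cstar_algebra"
  assumes h: "star h = h" and pos: "\<And>\<phi>. \<phi> \<in> states \<Longrightarrow> 0 \<le> Re (\<phi> h)"
  obtains \<phi> where "\<phi> \<in> states" "Re (\<phi> h) = norm h"
proof -
  obtain \<phi> where \<phi>: "\<phi> \<in> states" "cmod (\<phi> h) = norm h"
    using self_adjoint_state_attaining_norm[OF h] by metis
  then have "Re (\<phi> h) = norm h"
    using state_self_adjoint_real[OF \<phi>(1) h] pos[OF \<phi>(1)] by (simp add: cmod_eq_Re)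
  with \<phi>(1) show thesis by (rule that)
qed

section \<open>The numerical radius inequalities\<close>

lemma self_adjoint_star_mult_add_mult_star:
  "star (star x * x + x * star x) = star x * x + x * star (x::'a::unital_cstar_algebra)"
  by (simp add: star_add star_mult star_star)

text \<open>In a state attaining the norm of \<open>star x * x\<close>, the other summand
  contributes a nonnegative amount.\<close>

lemma norm_square_le_norm_star_mult_add_mult_star:
  fixes x :: "'a::unital_cstar_algebra"
  shows "(norm x)\<^sup>2 \<le> norm (star x * x + x * star x)"
proof -
  obtain \<phi> where \<phi>: "\<phi> \<in> states" "Re (\<phi> (star x * x)) = norm (star x * x)"
    using state_attaining_norm_nonneg[of "star x * x"] state_star_mult_self_nonneg
    by (metis star_mult star_star)
  have "0 \<le> Re (\<phi> (x * star x))"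
    using state_star_mult_self_nonneg[OF \<phi>(1), of "star x"] by (simp add: star_star)
  then have "(norm x)\<^sup>2 \<le> Re (\<phi> (star x * x + x * star x))"
    using \<phi>(2) by (simp add: state_add[OF \<phi>(1)] norm_star_mult_self)
  also have "\<dots> \<le> norm (star x * x + x * star x)"
    by (rule order_trans[OF complex_Re_le_cmod state_norm_le[OF \<phi>(1)]])
  finally show ?thesis .
qed

section \<open>Upper bound for the norm of \<open>star x * x + x * star x\<close>\<close>

lemma norm_power_two_power_self_adjoint:
  fixes h :: "'a::unital_cstar_algebra"
  assumes "star h = h"
  shows "norm (h ^ (2 ^ n)) = norm h ^ (2 ^ n)"
proof (induction n)
  case (Suc n)
  have "star (h ^ k) = h ^ k" for k
    by (induction k) (auto simp: star_mult assms power_commutes)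
  then have "norm (h ^ 2 ^ n * h ^ 2 ^ n) = (norm (h ^ 2 ^ n))\<^sup>2"
    by (rule norm_square_self_adjoint)
  then show ?case using Suc by (simp add: power_even_eq power2_eq_square)
qed simp

text \<open>If \<open>c < s\<close>, the powers of \<open>s / c\<close> outgrow the constant
  \<open>K\<close>, and the exponents \<open>2 ^ n\<close> are cofinal.\<close>

lemma le_if_power_two_power_le:
  fixes s c K :: real
  assumes "0 \<le> s" "0 < c" and le: "\<And>n. s ^ (2 ^ n) \<le> K * c ^ (2 ^ n)"
  shows "s \<le> c"
proof (rule ccontr)
  assume "\<not> s \<le> c"
  then have "1 < s / c" using assms by simp
  then obtain n where n: "K < (s / c) ^ n" using real_arch_pow by blast
  also have "\<dots> \<le> (s / c) ^ (2 ^ n)"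
    using \<open>1 < s / c\<close> by (intro power_increasing) (auto intro: less_imp_le)
  finally have "K * c ^ (2 ^ n) < s ^ (2 ^ n)"
    using assms by (simp add: power_divide field_simps)
  with le[of n] show False by simp
qed

text \<open>Put \<open>s = x\<^sup>* x + x x\<^sup>*\<close>. The identities \<open>x s = (x x\<^sup>*) x + x\<^sup>2 x\<^sup>*\<close> and
  \<open>x\<^sup>* s = (x\<^sup>*)\<^sup>2 x + (x\<^sup>* x) x\<^sup>*\<close> bound the norms of the powers of \<open>s\<close>.\<close>

lemma norm_star_mult_add_mult_star_le:
  fixes x :: "'a::unital_cstar_algebra"
  shows "norm (star x * x + x * star x) \<le> (norm x)\<^sup>2 + norm (x * x)"
proof (cases "x = 0")
  case False
  define s where "s = star x * x + x * star x"
  define c where "c = (norm x)\<^sup>2 + norm (x * x)"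
  have c: "0 < c" using False by (simp add: c_def add_pos_nonneg)
  have xx: "norm (star x * star x) = norm (x * x)" by (metis norm_star star_mult)
  have ind: "norm (x * s ^ n) \<le> norm x * c ^ n \<and> norm (star x * s ^ n) \<le> norm x * c ^ n" for n
  proof (induction n)
    case (Suc n)
    \<comment> \<open>In either identity the two coefficients have norms \<open>(norm x)^2\<close>
      and \<open>norm (x * x)\<close>, in some order, with sum \<open>c\<close>.\<close>
    have step: "norm (u * (x * s ^ n) + v * (star x * s ^ n)) \<le> norm x * c ^ Suc n"
      if "norm u + norm v = c" for u v
    proof -
      have "norm (u * (x * s ^ n) + v * (star x * s ^ n))
          \<le> norm u * norm (x * s ^ n) + norm v * norm (star x * s ^ n)"
        by (intro norm_triangle_mono norm_mult_ineq)
      also have "\<dots> \<le> norm u * (norm x * c ^ n) + norm v * (norm x * c ^ n)"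
        using Suc by (intro add_mono mult_left_mono) auto
      also have "\<dots> = norm x * c ^ Suc n"
        unfolding that[symmetric] by (simp add: algebra_simps)
      finally show ?thesis .
    qed
    have "x * s ^ Suc n = (x * star x) * (x * s ^ n) + (x * x) * (star x * s ^ n)"
      by (simp add: s_def algebra_simps)
    moreover have "star x * s ^ Suc n = (star x * star x) * (x * s ^ n) + (star x * x) * (star x * s ^ n)"
      by (simp add: s_def algebra_simps)
    ultimately show ?case
      using step[of "x * star x" "x * x"] step[of "star x * star x" "star x * x"]
      by (simp add: xx norm_mult_star_self norm_star_mult_self c_def)
  qed simp
  \<comment> \<open>Expanding one factor \<open>s\<close> costs \<open>2 * (norm x)^2\<close> in
    place of a factor \<open>c\<close>, hence the constant.\<close>
  have pow: "norm (s ^ Suc n) \<le> 2 * (norm x)\<^sup>2 / c * c ^ Suc n" for n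
  proof -
    have "s ^ Suc n = star x * (x * s ^ n) + x * (star x * s ^ n)"
      by (simp add: s_def algebra_simps)
    then have "norm (s ^ Suc n) \<le> norm (star x) * norm (x * s ^ n) + norm x * norm (star x * s ^ n)"
      by (metis norm_triangle_mono norm_mult_ineq)
    also have "\<dots> \<le> norm x * (norm x * c ^ n) + norm x * (norm x * c ^ n)"
      using ind[of n] by (intro add_mono) (auto intro: mult_left_mono)
    finally show ?thesis using c by (simp add: power2_eq_square)
  qed
  have "norm s \<le> c"
  proof (rule le_if_power_two_power_le[OF _ c])
    fix n
    have "norm s ^ (2 ^ n) = norm (s ^ (2 ^ n))"
      using norm_power_two_power_self_adjoint[OF self_adjoint_star_mult_add_mult_star, of x n]
      by (simp add: s_def)
    \<comment> \<open>\<open>pow\<close> speaks of successor exponents, and \<open>2 ^ n\<close> is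
      never zero.\<close>
    moreover have "(2::nat) ^ n = Suc (2 ^ n - 1)" by simp
    ultimately show "norm s ^ (2 ^ n) \<le> 2 * (norm x)\<^sup>2 / c * c ^ (2 ^ n)"
      using pow[of "2 ^ n - 1"] by metis
  qed simp
  then show ?thesis by (simp add: s_def c_def)
qed simp

section \<open>Bounds by the numerical radius and the Crawford number\<close>

lemma state_le_numerical_radius: "\<phi> \<in> states \<Longrightarrow> cmod (\<phi> z) \<le> numerical_radius z"
  unfolding numerical_radius_def
  by (intro cSUP_upper bdd_aboveI2[where M="norm z"] state_norm_le) auto

lemma numerical_radius_least:
  "(\<And>\<phi>. \<phi> \<in> states \<Longrightarrow> cmod (\<phi> z) \<le> c) \<Longrightarrow> numerical_radius z \<le> c"
  unfolding numerical_radius_def by (intro cSUP_least states_nonempty)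

lemma numerical_radius_nonneg: "0 \<le> numerical_radius z"
  using states_nonempty state_le_numerical_radius norm_ge_zero order_trans by (metis ex_in_conv)

lemma crawford_number_le: "\<phi> \<in> states \<Longrightarrow> crawford_number z \<le> cmod (\<phi> z)"
  unfolding crawford_number_def by (intro cINF_lower bdd_belowI2[where m=0]) auto

lemma crawford_number_nonneg: "0 \<le> crawford_number z"
  unfolding crawford_number_def by (intro cINF_greatest states_nonempty) auto

definition twice_Re :: "'a::unital_cstar_algebra \<Rightarrow> 'a" where
  "twice_Re x = x + star x"

lemma star_twice_Re: "star (twice_Re x) = twice_Re x"
  by (simp add: twice_Re_def star_add star_star add.commute)

lemma state_twice_Re: "\<phi> \<in> states \<Longrightarrow> Re (\<phi> (twice_Re x)) = 2 * Re (\<phi> x)"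
  by (simp add: twice_Re_def state_add state_star)

text \<open>In the mixed products \<open>u\<close> meets its conjugate and disappears; the other two
  are \<open>u^2 x^2\<close> and its adjoint, with conjugate values in the state.\<close>

lemma state_twice_Re_square:
  assumes \<phi>: "\<phi> \<in> states" and u: "cmod u = 1"
  shows "Re (\<phi> (twice_Re (u *\<^sub>C x) * twice_Re (u *\<^sub>C x)))
    = Re (\<phi> (star x * x + x * star x)) + 2 * Re (u\<^sup>2 * \<phi> (x * x))"
proof -
  have uu: "u * cnj u = 1" "cnj u * u = 1" using u by (simp_all add: complex_norm_square[symmetric] mult.commute)
  have "twice_Re (u *\<^sub>C x) * twice_Re (u *\<^sub>C x)
      = (star x * x + x * star x) + (u\<^sup>2 *\<^sub>C (x * x) + star (u\<^sup>2 *\<^sub>C (x * x)))"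
    by (simp add: twice_Re_def star_scaleC star_mult algebra_simps mult_scaleC_left mult_scaleC_right
        scaleC_scaleC scaleC_add_right uu power2_eq_square)
  then show ?thesis
    by (simp add: state_add[OF \<phi>] state_star[OF \<phi>] state_scaleC[OF \<phi>]
        del: complex_cnj_mult complex_cnj_power times_complex.sel)
qed

lemma cmod_state_square_le:
  assumes \<phi>: "\<phi> \<in> states"
  shows "4 * (cmod (\<phi> x))\<^sup>2 \<le> norm (star x * x + x * star x) + 2 * numerical_radius (x * x)"
proof -
  obtain u where u: "cmod u = 1" "u * \<phi> x = of_real (cmod (\<phi> x))"
    using unit_complex_rotating by metis
  have "Re (\<phi> (twice_Re (u *\<^sub>C x))) = 2 * cmod (\<phi> x)"
    using u(2) by (simp add: state_twice_Re[OF \<phi>] state_scaleC[OF \<phi>])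
  then have "4 * (cmod (\<phi> x))\<^sup>2 \<le> Re (\<phi> (twice_Re (u *\<^sub>C x) * twice_Re (u *\<^sub>C x)))"
    using state_square_ge[OF \<phi> star_twice_Re, of "u *\<^sub>C x"] by (simp add: power_mult_distrib)
  also have "\<dots> = Re (\<phi> (star x * x + x * star x)) + 2 * Re (u\<^sup>2 * \<phi> (x * x))"
    by (rule state_twice_Re_square[OF \<phi> u(1)])
  also have "\<dots> \<le> norm (star x * x + x * star x) + 2 * numerical_radius (x * x)"
  proof (intro add_mono mult_left_mono)
    show "Re (\<phi> (star x * x + x * star x)) \<le> norm (star x * x + x * star x)"
      by (rule order_trans[OF complex_Re_le_cmod state_norm_le[OF \<phi>]])
    have "Re (u\<^sup>2 * \<phi> (x * x)) \<le> cmod (\<phi> (x * x))"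
      using complex_Re_le_cmod[of "u\<^sup>2 * \<phi> (x * x)"] u(1) by (simp add: norm_mult norm_power)
    then show "Re (u\<^sup>2 * \<phi> (x * x)) \<le> numerical_radius (x * x)"
      using state_le_numerical_radius[OF \<phi>] order_trans by blast
  qed simp
  finally show ?thesis .
qed

lemma norm_twice_Re_le:
  assumes "cmod u = 1"
  shows "norm (twice_Re (u *\<^sub>C x)) \<le> 2 * numerical_radius x"
proof -
  obtain \<phi> where \<phi>: "\<phi> \<in> states" "cmod (\<phi> (twice_Re (u *\<^sub>C x))) = norm (twice_Re (u *\<^sub>C x))"
    using self_adjoint_state_attaining_norm[OF star_twice_Re] by metis
  have "norm (twice_Re (u *\<^sub>C x)) = \<bar>Re (\<phi> (twice_Re (u *\<^sub>C x)))\<bar>"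
    using state_self_adjoint_real[OF \<phi>(1) star_twice_Re, of "u *\<^sub>C x"] \<phi>(2) by (simp add: cmod_eq_Re)
  also have "\<dots> = 2 * \<bar>Re (u * \<phi> x)\<bar>"
    by (simp add: state_twice_Re[OF \<phi>(1)] state_scaleC[OF \<phi>(1)] abs_mult del: times_complex.sel)
  also have "\<dots> \<le> 2 * cmod (\<phi> x)"
    using abs_Re_le_cmod[of "u * \<phi> x"] assms by (simp add: norm_mult)
  also have "\<dots> \<le> 2 * numerical_radius x"
    using state_le_numerical_radius[OF \<phi>(1)] by simp
  finally show ?thesis .
qed

lemma crawford_lower_bound:
  "norm (star x * x + x * star x) + 2 * crawford_number (x * x) \<le> 4 * (numerical_radius x)\<^sup>2"
proof -
  obtain \<phi> where \<phi>: "\<phi> \<in> states"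
    "Re (\<phi> (star x * x + x * star x)) = norm (star x * x + x * star x)"
    using state_attaining_norm_nonneg[OF self_adjoint_star_mult_add_mult_star]
      state_star_mult_add_mult_star_nonneg by metis
  obtain w where w: "cmod w = 1" "w * \<phi> (x * x) = of_real (cmod (\<phi> (x * x)))"
    using unit_complex_rotating by metis
  \<comment> \<open>The rotation enters the expansion squared, so a square root of the factor that
    rotates \<open>\<phi> (x * x)\<close> is taken.\<close>
  define u where "u = csqrt w"
  have u: "u\<^sup>2 = w" "cmod u = 1" using w(1) by (auto simp: u_def)
  have "norm (star x * x + x * star x) + 2 * crawford_number (x * x)
      \<le> Re (\<phi> (star x * x + x * star x)) + 2 * Re (u\<^sup>2 * \<phi> (x * x))"
    using crawford_number_le[OF \<phi>(1), of "x * x"] by (simp add: u(1) w(2) \<phi>(2))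
  also have "\<dots> = Re (\<phi> (twice_Re (u *\<^sub>C x) * twice_Re (u *\<^sub>C x)))"
    by (rule state_twice_Re_square[OF \<phi>(1) u(2), symmetric])
  also have "\<dots> \<le> norm (twice_Re (u *\<^sub>C x) * twice_Re (u *\<^sub>C x))"
    by (rule order_trans[OF complex_Re_le_cmod state_norm_le[OF \<phi>(1)]])
  also have "\<dots> = (norm (twice_Re (u *\<^sub>C x)))\<^sup>2" by (rule norm_square_self_adjoint[OF star_twice_Re])
  also have "\<dots> \<le> (2 * numerical_radius x)\<^sup>2" by (intro power_mono norm_twice_Re_le u(2)) simp
  finally show ?thesis by (simp add: power_mult_distrib)
qed

theorem theorem2p3:
  fixes x :: "'a::unital_cstar_algebra"
  shows "(1/2 * norm x
            \<le> 1/2 * sqrt (norm (star x * x + x * star x) + 2 * crawford_number (x\<^sup>2))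
        \<and> 1/2 * sqrt (norm (star x * x + x * star x) + 2 * crawford_number (x\<^sup>2))
            \<le> numerical_radius x)
      \<and> (numerical_radius x
            \<le> 1/2 * sqrt (norm (star x * x + x * star x) + 2 * numerical_radius (x\<^sup>2))
        \<and> 1/2 * sqrt (norm (star x * x + x * star x) + 2 * numerical_radius (x\<^sup>2))
            \<le> 1/2 * (norm x + sqrt (norm (x\<^sup>2)))
        \<and> 1/2 * (norm x + sqrt (norm (x\<^sup>2))) \<le> norm x)"
proof -
  let ?s = "norm (star x * x + x * star x)" and ?w = "sqrt (norm (x\<^sup>2))"
  have w: "?w\<^sup>2 = norm (x\<^sup>2)" "0 \<le> ?w" by simp_all
  have wx: "?w \<le> norm x"
    by (rule real_le_lsqrt) (auto simp: norm_power_ineq)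
  have "(norm x)\<^sup>2 \<le> ?s + 2 * crawford_number (x\<^sup>2)"
    using norm_square_le_norm_star_mult_add_mult_star[of x] crawford_number_nonneg[of "x\<^sup>2"] by simp
  then have 1: "norm x \<le> sqrt (?s + 2 * crawford_number (x\<^sup>2))" by (rule real_le_rsqrt)
  have "?s + 2 * crawford_number (x\<^sup>2) \<le> (2 * numerical_radius x)\<^sup>2"
    using crawford_lower_bound[of x] by (simp add: power_mult_distrib power2_eq_square[of x])
  then have 2: "sqrt (?s + 2 * crawford_number (x\<^sup>2)) \<le> 2 * numerical_radius x"
    using numerical_radius_nonneg[of x] by (intro real_le_lsqrt) auto
  have 3: "numerical_radius x \<le> 1/2 * sqrt (?s + 2 * numerical_radius (x\<^sup>2))"
  proof (rule numerical_radius_least)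
    fix \<phi> :: "'a \<Rightarrow> complex" assume "\<phi> \<in> states"
    from cmod_state_square_le[OF this, of x]
    have "(2 * cmod (\<phi> x))\<^sup>2 \<le> ?s + 2 * numerical_radius (x\<^sup>2)"
      by (simp add: power_mult_distrib power2_eq_square[of x])
    then have "2 * cmod (\<phi> x) \<le> sqrt (?s + 2 * numerical_radius (x\<^sup>2))" by (rule real_le_rsqrt)
    then show "cmod (\<phi> x) \<le> 1/2 * sqrt (?s + 2 * numerical_radius (x\<^sup>2))" by simp
  qed
  \<comment> \<open>Weakening \<open>norm (x^2)\<close> to \<open>norm x\<close> times its square
    root turns the bound into a perfect square.\<close>
  have "?s + 2 * numerical_radius (x\<^sup>2) \<le> ((norm x)\<^sup>2 + ?w\<^sup>2) + 2 * (norm x * ?w)"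
  proof (intro add_mono mult_left_mono)
    show "?s \<le> (norm x)\<^sup>2 + ?w\<^sup>2"
      using norm_star_mult_add_mult_star_le[of x] by (simp add: power2_eq_square[of x])
    have "numerical_radius (x\<^sup>2) \<le> ?w * ?w"
      by (simp add: numerical_radius_least state_norm_le)
    also have "\<dots> \<le> norm x * ?w" using wx by (intro mult_right_mono) auto
    finally show "numerical_radius (x\<^sup>2) \<le> norm x * ?w" .
  qed simp
  also have "\<dots> = (norm x + ?w)\<^sup>2" by (simp add: power2_sum)
  finally have 4: "sqrt (?s + 2 * numerical_radius (x\<^sup>2)) \<le> norm x + ?w"
    by (intro real_le_lsqrt) auto
  from 1 2 3 4 wx show ?thesis by simp
qed

end
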